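(* Let $\alpha,\beta$ be real numbers with $0<\alpha<4\beta$. For $\operatorname{Im}\tau>0$, $q=e^{\pi i\tau}$ and $u,v\in\mathbf C$, let $$\widehat{A}_{\alpha,\beta}(u,v|\tau)=\sum_{m,n\in\mathbf Z}q^{\alpha m^2+\alpha mn+\beta n^2}e^{2iu(2m+n)}e^{2ivn}$$ and $$\widehat{C}_{\alpha,\beta}(u,v|\tau)=\sum_{m,n\in\mathbf Z}q^{\alpha m^2+\alpha mn+\beta n^2+\alpha m+\alpha n/2+\alpha/4}e^{2iu(2m+n+1)}e^{2ivn}.$$ Then for all $u,v\in\mathbf C$ and all $\tau$ with $\operatorname{Im}\tau>0$, $$\widehat{A}_{\alpha,\beta}(u,v|4\tau)-\widehat{C}_{\alpha,\beta}(u,v|4\tau)=\vartheta_4(u|\alpha\tau)\,\vartheta_4(v|(4\beta-\alpha)\tau).$$ Moreover, $$\widehat{A}_{\alpha,\beta}^2(u,v|\tau)-\widehat{C}_{\alpha,\beta}^2(u,v|\tau)=\widehat{A}_{\alpha,\beta}^2(u,v+\pi/2|\tau)-\widehat{C}_{\alpha,\beta}^2(u,v+\pi/2|\tau).$$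
   Context: For $\operatorname{Im}\tau>0$, $q=e^{\pi i\tau}$ with real powers $q^r=e^{\pi i r\tau}$; when the last argument is another value $\tau'$ (such as $4\tau$), $q$ is replaced throughout the definition by $e^{\pi i\tau'}$. The theta function is $\vartheta_4(z|\tau)=\sum_{n=-\infty}^\infty(-1)^nq^{n^2}e^{2niz}$. Squares such as $\widehat{A}_{\alpha,\beta}^2(u,v|\tau)$ denote $(\widehat{A}_{\alpha,\beta}(u,v|\tau))^2$. *)

theory Defs
  imports "HOL-Analysis.Analysis"
begin

text \<open>
  The real power \<open>q\<^sup>r\<close> of the nome \<open>q = exp (\<pi> \<i> \<tau>)\<close>. The branch is fixed by \<open>\<tau>\<close>, not by the
  value of \<open>q\<close>, so \<open>\<tau>\<close> (and not \<open>q\<close>) is the parameter.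
\<close>

definition nome_pow :: "complex \<Rightarrow> real \<Rightarrow> complex" where
  "nome_pow \<tau> r = exp (of_real pi * \<i> * of_real r * \<tau>)"

definition theta4 :: "complex \<Rightarrow> complex \<Rightarrow> complex" where
  "theta4 z \<tau> = (\<Sum>\<^sub>\<infinity>n\<in>(UNIV::int set).
     (-1) powi n * nome_pow \<tau> (of_int n ^ 2) * exp (2 * of_int n * \<i> * z))"

definition A_hat :: "real \<Rightarrow> real \<Rightarrow> complex \<Rightarrow> complex \<Rightarrow> complex \<Rightarrow> complex" where
  "A_hat \<alpha> \<beta> u v \<tau> = (\<Sum>\<^sub>\<infinity>(m, n)\<in>(UNIV::(int \<times> int) set).
     nome_pow \<tau> (\<alpha> * of_int m ^ 2 + \<alpha> * of_int m * of_int n + \<beta> * of_int n ^ 2)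
       * exp (2 * \<i> * u * of_int (2 * m + n)) * exp (2 * \<i> * v * of_int n))"

definition C_hat :: "real \<Rightarrow> real \<Rightarrow> complex \<Rightarrow> complex \<Rightarrow> complex \<Rightarrow> complex" where
  "C_hat \<alpha> \<beta> u v \<tau> = (\<Sum>\<^sub>\<infinity>(m, n)\<in>(UNIV::(int \<times> int) set).
     nome_pow \<tau> (\<alpha> * of_int m ^ 2 + \<alpha> * of_int m * of_int n + \<beta> * of_int n ^ 2
                  + \<alpha> * of_int m + \<alpha> * of_int n / 2 + \<alpha> / 4)
       * exp (2 * \<i> * u * of_int (2 * m + n + 1)) * exp (2 * \<i> * v * of_int n))"

end

theory Submission
  imports Defs
begin

text \<open>
  With \<open>N = 2m + n\<close> resp. \<open>N = 2m + n + 1\<close>, both quadratic forms at \<open>4\<tau>\<close> become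
  \<open>\<alpha>N\<^sup>2 + (4\<beta> - \<alpha>)n\<^sup>2\<close>, so \<open>A - C\<close> is the double series of the theta product, split according to
  the parity of \<open>N + n\<close>. The shift \<open>(u, v) \<mapsto> (u + \<pi>/2, v + \<pi>/2)\<close> fixes \<open>A\<close> and negates \<open>C\<close>; hence
  \<open>A + C\<close> is a theta product too, and \<open>A\<^sup>2 - C\<^sup>2\<close> is a product of four theta values, which
  \<open>v \<mapsto> v + \<pi>/2\<close> permutes because \<open>theta4\<close> has period \<open>\<pi>\<close>.
\<close>

definition theta4_term :: "complex \<Rightarrow> complex \<Rightarrow> int \<Rightarrow> complex" where
  "theta4_term z \<tau> n = (-1) powi n * nome_pow \<tau> (of_int n ^ 2) * exp (2 * of_int n * \<i> * z)"

lemma theta4_eq_infsum: "theta4 z \<tau> = (\<Sum>\<^sub>\<infinity>n. theta4_term z \<tau> n)"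
  by (simp add: theta4_def theta4_term_def)

text \<open>The dominating series for the theta terms: a geometric series on each half-line. Both
  halves contain 0, which is harmless because summability on a union does not ask for
  disjointness.\<close>

lemma summable_on_exp_minus_abs_int: "(\<lambda>n::int. exp (- \<bar>real_of_int n\<bar>)) summable_on UNIV"
proof -
  let ?f = "\<lambda>n::int. exp (- \<bar>real_of_int n\<bar>)"
  have "summable (\<lambda>n. exp (- 1) ^ n :: real)"
    by (rule summable_geometric) simp
  then have "(\<lambda>n. exp (- real n)) summable_on UNIV"
    by (intro summable_nonneg_imp_summable_on) (simp_all flip: exp_of_nat_mult)
  then have "?f summable_on range int" "?f summable_on range (\<lambda>n. - int n)"
    by (simp_all add: summable_on_reindex inj_on_def o_def)
  then have "?f summable_on (range int \<union> range (\<lambda>n. - int n))"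
    by (rule summable_on_union)
  moreover have "k \<in> range int \<union> range (\<lambda>n. - int n)" for k
    by (cases k rule: int_cases2) auto
  then have "range int \<union> range (\<lambda>n. - int n) = UNIV"
    by blast
  ultimately show ?thesis
    by simp
qed

text \<open>Completing the square in |x|. The slope is |b| + 1 rather than |b|, so that a spare -|x|
  survives and gives geometric decay after exponentiation.\<close>

lemma quadratic_le_linear:
  fixes a b x :: real
  assumes "0 < a"
  shows "b * x - a * x\<^sup>2 \<le> (\<bar>b\<bar> + 1)\<^sup>2 / (4 * a) - \<bar>x\<bar>"
proof -
  have "0 \<le> (2 * a * \<bar>x\<bar> - (\<bar>b\<bar> + 1))\<^sup>2 / (4 * a)"
    using assms by simp
  also have "\<dots> = a * x\<^sup>2 - (\<bar>b\<bar> + 1) * \<bar>x\<bar> + (\<bar>b\<bar> + 1)\<^sup>2 / (4 * a)"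
    using assms by (simp add: field_simps power2_eq_square)
  finally show ?thesis
    using abs_ge_self[of "b * x"] by (simp add: abs_mult algebra_simps)
qed

lemma theta4_term_abs_summable:
  assumes "Im \<tau> > 0"
  shows "(\<lambda>n. norm (theta4_term z \<tau> n)) summable_on UNIV"
proof (rule Infinite_Sum.abs_summable_on_comparison_test')
  \<comment> \<open>These come from |q^(n^2)| = exp (-pi n^2 Im \<tau>) and |exp (2 n i z)| = exp
    (-2 n Im z); the sign has norm 1.\<close>
  let ?a = "pi * Im \<tau>" and ?b = "- 2 * Im z"
  let ?K = "exp ((\<bar>?b\<bar> + 1)\<^sup>2 / (4 * ?a))"
  show "(\<lambda>n. ?K * exp (- \<bar>real_of_int n\<bar>)) summable_on UNIV"
    by (intro summable_on_cmult_right summable_on_exp_minus_abs_int)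
  fix n :: int
  have "norm (theta4_term z \<tau> n) = exp (?b * n - ?a * (real_of_int n)\<^sup>2)"
    by (simp add: theta4_term_def nome_pow_def norm_mult norm_power_int algebra_simps
          flip: exp_add of_int_power)
  also have "\<dots> \<le> exp ((\<bar>?b\<bar> + 1)\<^sup>2 / (4 * ?a) - \<bar>real_of_int n\<bar>)"
    using assms by (subst exp_le_cancel_iff, intro quadratic_le_linear) simp
  also have "\<dots> = ?K * exp (- \<bar>real_of_int n\<bar>)"
    by (simp flip: exp_add)
  finally show "norm (theta4_term z \<tau> n) \<le> ?K * exp (- \<bar>real_of_int n\<bar>)" .
qed

text \<open>The row sums of the norms are |f x| times the sum of |g y|, hence summable in x.
  Absolute convergence of the double family then allows both the iterated summation and, later, the
  split by parity.\<close>

lemma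
  fixes f :: "'a \<Rightarrow> complex" and g :: "'b \<Rightarrow> complex"
  assumes f: "(\<lambda>x. norm (f x)) summable_on A" and g: "(\<lambda>y. norm (g y)) summable_on B"
  shows summable_on_product_complex: "(\<lambda>(x, y). f x * g y) summable_on A \<times> B"
    and infsum_product_complex: "(\<Sum>\<^sub>\<infinity>(x, y)\<in>A \<times> B. f x * g y) = infsum f A * infsum g B"
proof -
  have "(\<lambda>p. norm (case p of (x, y) \<Rightarrow> f x * g y)) summable_on A \<times> B"
    unfolding Infinite_Sum.abs_summable_on_Sigma_iff using f g
    by (auto simp: norm_mult abs_mult infsum_cmult_right' intro!: summable_on_cmult_right summable_on_cmult_left)
  then show sum: "(\<lambda>(x, y). f x * g y) summable_on A \<times> B"
    by (rule abs_summable_summable)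
  show "(\<Sum>\<^sub>\<infinity>(x, y)\<in>A \<times> B. f x * g y) = infsum f A * infsum g B"
    using infsum_Sigma'_banach[OF sum]
    by (simp add: infsum_cmult_right' infsum_cmult_left')
qed

text \<open>The map (m, n) to (2m + n, n) is a bijection onto the pairs of equal parity, where the
  two theta signs cancel. The division by 2 in its inverse is exact there.\<close>

lemma A_hat_eq_even_part:
  "A_hat \<alpha> \<beta> u v (4 * \<tau>) = (\<Sum>\<^sub>\<infinity>(k, n)\<in>{(k, n). even (k + n)}.
     theta4_term u (of_real \<alpha> * \<tau>) k * theta4_term v (of_real (4 * \<beta> - \<alpha>) * \<tau>) n)"
  unfolding A_hat_def
proof (rule infsum_reindex_bij_witness
    [where j = "\<lambda>(m, n). (2 * m + n, n)" and i = "\<lambda>(k, n). ((k - n) div 2, n)"])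
  fix p :: "int \<times> int"
  obtain m n where p: "p = (m, n)" by fastforce
  have sgn: "(- 1 :: complex) powi (2 * m + n) * (- 1) powi n = 1"
    by (auto simp: power_int_minus_left)
  have "theta4_term u (of_real \<alpha> * \<tau>) (2 * m + n) * theta4_term v (of_real (4 * \<beta> - \<alpha>) * \<tau>) n
      = ((- 1) powi (2 * m + n) * (- 1) powi n)
        * (nome_pow (of_real \<alpha> * \<tau>) (of_int (2 * m + n) ^ 2)
           * nome_pow (of_real (4 * \<beta> - \<alpha>) * \<tau>) (of_int n ^ 2)
           * exp (2 * of_int (2 * m + n) * \<i> * u) * exp (2 * of_int n * \<i> * v))"
    by (simp add: theta4_term_def mult_ac)
  also have "\<dots> = nome_pow (4 * \<tau>) (\<alpha> * of_int m ^ 2 + \<alpha> * of_int m * of_int n + \<beta> * of_int n ^ 2)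
       * exp (2 * \<i> * u * of_int (2 * m + n)) * exp (2 * \<i> * v * of_int n)"
    unfolding sgn
    by (simp add: nome_pow_def algebra_simps power2_eq_square flip: exp_add)
  finally show "(case case p of (m, n) \<Rightarrow> (2 * m + n, n) of
      (k, n) \<Rightarrow> theta4_term u (of_real \<alpha> * \<tau>) k * theta4_term v (of_real (4 * \<beta> - \<alpha>) * \<tau>) n)
    = (case p of (m, n) \<Rightarrow>
        nome_pow (4 * \<tau>) (\<alpha> * of_int m ^ 2 + \<alpha> * of_int m * of_int n + \<beta> * of_int n ^ 2)
       * exp (2 * \<i> * u * of_int (2 * m + n)) * exp (2 * \<i> * v * of_int n))"
    by (simp add: p)
qed auto

text \<open>The linear terms in the exponent of \<open>C_hat\<close> are those that complete the
  square (2m + n + 1)^2. The pairs now have opposite parity, so the signs multiply to -1; this is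
  where the minus in A - C originates.\<close>

lemma C_hat_eq_odd_part:
  "C_hat \<alpha> \<beta> u v (4 * \<tau>) = (\<Sum>\<^sub>\<infinity>(k, n)\<in>{(k, n). odd (k + n)}.
     - (theta4_term u (of_real \<alpha> * \<tau>) k * theta4_term v (of_real (4 * \<beta> - \<alpha>) * \<tau>) n))"
  unfolding C_hat_def
proof (rule infsum_reindex_bij_witness
    [where j = "\<lambda>(m, n). (2 * m + n + 1, n)" and i = "\<lambda>(k, n). ((k - n - 1) div 2, n)"])
  fix p :: "int \<times> int"
  obtain m n where p: "p = (m, n)" by fastforce
  have sgn: "(- 1 :: complex) powi (2 * m + n + 1) * (- 1) powi n = - 1"
    by (auto simp: power_int_minus_left)
  have "- (theta4_term u (of_real \<alpha> * \<tau>) (2 * m + n + 1)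
           * theta4_term v (of_real (4 * \<beta> - \<alpha>) * \<tau>) n)
      = - ((- 1) powi (2 * m + n + 1) * (- 1) powi n)
        * (nome_pow (of_real \<alpha> * \<tau>) (of_int (2 * m + n + 1) ^ 2)
           * nome_pow (of_real (4 * \<beta> - \<alpha>) * \<tau>) (of_int n ^ 2)
           * exp (2 * of_int (2 * m + n + 1) * \<i> * u) * exp (2 * of_int n * \<i> * v))"
    by (simp add: theta4_term_def mult_ac)
  also have "\<dots> = nome_pow (4 * \<tau>) (\<alpha> * of_int m ^ 2 + \<alpha> * of_int m * of_int n + \<beta> * of_int n ^ 2
                  + \<alpha> * of_int m + \<alpha> * of_int n / 2 + \<alpha> / 4)
       * exp (2 * \<i> * u * of_int (2 * m + n + 1)) * exp (2 * \<i> * v * of_int n)"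
    unfolding sgn
    by (simp add: nome_pow_def algebra_simps power2_eq_square flip: exp_add)
  finally show "(case case p of (m, n) \<Rightarrow> (2 * m + n + 1, n) of
      (k, n) \<Rightarrow> - (theta4_term u (of_real \<alpha> * \<tau>) k * theta4_term v (of_real (4 * \<beta> - \<alpha>) * \<tau>) n))
    = (case p of (m, n) \<Rightarrow>
        nome_pow (4 * \<tau>) (\<alpha> * of_int m ^ 2 + \<alpha> * of_int m * of_int n + \<beta> * of_int n ^ 2
                  + \<alpha> * of_int m + \<alpha> * of_int n / 2 + \<alpha> / 4)
       * exp (2 * \<i> * u * of_int (2 * m + n + 1)) * exp (2 * \<i> * v * of_int n))"
    by (simp add: p)
qed (auto elim!: oddE)

lemma A_hat_minus_C_hat:
  assumes "0 < \<alpha>" and "\<alpha> < 4 * \<beta>" and "Im \<tau> > 0"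
  shows "A_hat \<alpha> \<beta> u v (4 * \<tau>) - C_hat \<alpha> \<beta> u v (4 * \<tau>)
           = theta4 u (of_real \<alpha> * \<tau>) * theta4 v (of_real (4 * \<beta> - \<alpha>) * \<tau>)"
proof -
  let ?f = "theta4_term u (of_real \<alpha> * \<tau>)" and ?g = "theta4_term v (of_real (4 * \<beta> - \<alpha>) * \<tau>)"
  let ?h = "\<lambda>(k, n). ?f k * ?g n"
  let ?E = "{(k, n). even (k + n)} :: (int \<times> int) set"
  let ?O = "{(k, n). odd (k + n)} :: (int \<times> int) set"
  \<comment> \<open>Since \<alpha> and 4 \<beta> - \<alpha> are positive, both theta parameters lie
    in the upper half-plane.\<close>
  have f: "(\<lambda>k. norm (?f k)) summable_on UNIV" and g: "(\<lambda>n. norm (?g n)) summable_on UNIV"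
    using assms by (intro theta4_term_abs_summable; simp)+
  have h: "?h summable_on UNIV"
    using summable_on_product_complex[OF f g] by simp
  have "theta4 u (of_real \<alpha> * \<tau>) * theta4 v (of_real (4 * \<beta> - \<alpha>) * \<tau>) = infsum ?h UNIV"
    using infsum_product_complex[OF f g] by (simp add: theta4_eq_infsum)
  also have "UNIV = ?E \<union> ?O"
    by auto
  also have "infsum ?h (?E \<union> ?O) = infsum ?h ?E + infsum ?h ?O"
    by (intro infsum_Un_disjoint summable_on_subset[OF h]) auto
  also have "infsum ?h ?E = A_hat \<alpha> \<beta> u v (4 * \<tau>)"
    by (simp only: A_hat_eq_even_part)
  also have "infsum ?h ?O = - C_hat \<alpha> \<beta> u v (4 * \<tau>)"
    by (simp add: C_hat_eq_odd_part case_prod_unfold infsum_uminus)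
  finally show ?thesis
    by simp
qed

lemma exp_half_period_shift:
  "exp (2 * \<i> * (z + of_real pi / 2) * of_int k) = (-1) powi k * exp (2 * \<i> * z * of_int k)"
proof -
  have "exp (2 * \<i> * (z + of_real pi / 2) * of_int k)
      = exp (of_int k * (of_real pi * \<i>)) * exp (2 * \<i> * z * of_int k)"
    by (simp add: algebra_simps flip: exp_add)
  then show ?thesis
    by (simp add: exp_pi_i flip: exp_power_int)
qed

text \<open>The term at (m, n) gains the sign (-1)^(2m + n) from u and (-1)^n from v, with even
  total exponent.\<close>

lemma A_hat_shift_both:
  "A_hat \<alpha> \<beta> (u + of_real pi / 2) (v + of_real pi / 2) \<tau> = A_hat \<alpha> \<beta> u v \<tau>"
  unfolding A_hat_def exp_half_period_shift
  by (intro infsum_cong) (auto simp: power_int_minus_left)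

text \<open>Here the sign exponents add up to 2m + 2n + 1, which is odd.\<close>

lemma C_hat_shift_both:
  "C_hat \<alpha> \<beta> (u + of_real pi / 2) (v + of_real pi / 2) \<tau> = - C_hat \<alpha> \<beta> u v \<tau>"
  unfolding C_hat_def exp_half_period_shift infsum_uminus[symmetric]
  by (intro infsum_cong) (auto simp: power_int_minus_left)

text \<open>Stated with two half-shifts to match the terms that arise when v + pi/2 is substituted
  for v in the product formula.\<close>

lemma theta4_periodic: "theta4 (z + of_real pi / 2 + of_real pi / 2) \<tau> = theta4 z \<tau>"
proof -
  have "exp (2 * of_int n * \<i> * (z + of_real pi / 2 + of_real pi / 2)) = exp (2 * of_int n * \<i> * z)"
    for n
    using exp_half_period_shift[of "z + of_real pi / 2" n] exp_half_period_shift[of z n]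
    by (simp add: mult_ac power_int_minus_left split: if_splits)
  then show ?thesis
    by (simp add: theta4_def)
qed

lemma A_hat_sq_minus_C_hat_sq:
  assumes "0 < \<alpha>" and "\<alpha> < 4 * \<beta>" and "Im \<tau> > 0"
  shows "(A_hat \<alpha> \<beta> u v (4 * \<tau>))\<^sup>2 - (C_hat \<alpha> \<beta> u v (4 * \<tau>))\<^sup>2
    = theta4 u (of_real \<alpha> * \<tau>) * theta4 (u + of_real pi / 2) (of_real \<alpha> * \<tau>)
      * (theta4 v (of_real (4 * \<beta> - \<alpha>) * \<tau>)
         * theta4 (v + of_real pi / 2) (of_real (4 * \<beta> - \<alpha>) * \<tau>))"
proof -
  \<comment> \<open>Difference of two squares, with A + C rewritten as A - C at the shifted point,
    so that \<open>A_hat_minus_C_hat\<close> covers both factors.\<close>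
  have "(A_hat \<alpha> \<beta> u v (4 * \<tau>))\<^sup>2 - (C_hat \<alpha> \<beta> u v (4 * \<tau>))\<^sup>2
    = (A_hat \<alpha> \<beta> u v (4 * \<tau>) - C_hat \<alpha> \<beta> u v (4 * \<tau>))
      * (A_hat \<alpha> \<beta> (u + of_real pi / 2) (v + of_real pi / 2) (4 * \<tau>)
         - C_hat \<alpha> \<beta> (u + of_real pi / 2) (v + of_real pi / 2) (4 * \<tau>))"
    unfolding A_hat_shift_both C_hat_shift_both by (simp add: power2_eq_square algebra_simps)
  then show ?thesis
    unfolding A_hat_minus_C_hat[OF assms] by (simp only: mult_ac)
qed

theorem theorem5p2:
  fixes \<alpha> \<beta> :: real and u v \<tau> :: complex
  assumes "0 < \<alpha>" and "\<alpha> < 4 * \<beta>" and "Im \<tau> > 0"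
  shows "A_hat \<alpha> \<beta> u v (4 * \<tau>) - C_hat \<alpha> \<beta> u v (4 * \<tau>)
           = theta4 u (of_real \<alpha> * \<tau>) * theta4 v (of_real (4 * \<beta> - \<alpha>) * \<tau>)
       \<and> (A_hat \<alpha> \<beta> u v \<tau>)\<^sup>2 - (C_hat \<alpha> \<beta> u v \<tau>)\<^sup>2
           = (A_hat \<alpha> \<beta> u (v + of_real pi / 2) \<tau>)\<^sup>2 - (C_hat \<alpha> \<beta> u (v + of_real pi / 2) \<tau>)\<^sup>2"
proof
  show "A_hat \<alpha> \<beta> u v (4 * \<tau>) - C_hat \<alpha> \<beta> u v (4 * \<tau>)
      = theta4 u (of_real \<alpha> * \<tau>) * theta4 v (of_real (4 * \<beta> - \<alpha>) * \<tau>)"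
    by (rule A_hat_minus_C_hat[OF assms])
  \<comment> \<open>The product formula lives at four times its parameter, so it is applied at
    \<tau>/4.\<close>
  have "Im (\<tau> / 4) > 0"
    using assms(3) by simp
  note prod = A_hat_sq_minus_C_hat_sq[OF assms(1,2) this]
  have "4 * (\<tau> / 4) = \<tau>"
    by simp
  then show "(A_hat \<alpha> \<beta> u v \<tau>)\<^sup>2 - (C_hat \<alpha> \<beta> u v \<tau>)\<^sup>2
      = (A_hat \<alpha> \<beta> u (v + of_real pi / 2) \<tau>)\<^sup>2 - (C_hat \<alpha> \<beta> u (v + of_real pi / 2) \<tau>)\<^sup>2"
    \<comment> \<open>In the second instance the v-factors sit at v + pi/2 and v + pi; by
      periodicity these are the factors of the first instance in swapped order.\<close>
    using prod[of u v] prod[of u "v + of_real pi / 2"]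
    by (simp only: theta4_periodic mult_ac)
qed

end
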